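(* Let $\lambda$ be a nonzero real number and let $x,y\in\mathbb{R}$. For every integer $n\ge 0$, \begin{align*} C_{n,\lambda}(x,y)&=\sum_{m=0}^{n}\sum_{k=0}^{[\frac{m}{2}]}\binom{n}{m}\lambda^{m-2k}(-1)^{k}y^{2k}S^{(1)}(m,2k)(x)_{n-m,\lambda}\\ &=\sum_{k=0}^{[\frac{n}{2}]}\sum_{m=2k}^{n}\binom{n}{m}\lambda^{m-2k}(-1)^{k}y^{2k}S^{(1)}(m,2k)(x)_{n-m,\lambda}. \end{align*} Also, for every integer $n\ge 1$, \begin{align*} S_{n,\lambda}(x,y)&=\sum_{m=1}^{n}\sum_{k=0}^{[\frac{m-1}{2}]}\binom{n}{m}\lambda^{m-2k-1}(-1)^{k}y^{2k+1}S^{(1)}(m,2k+1)(x)_{n-m,\lambda}\\ &=\sum_{k=0}^{[\frac{n-1}{2}]}\sum_{m=2k+1}^{n}\binom{n}{m}\lambda^{m-2k-1}(-1)^{k}y^{2k+1}S^{(1)}(m,2k+1)(x)_{n-m,\lambda}, \end{align*} and $S_{0,\lambda}(x,y)=0$.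
   Context: All generating functions are power series in $t$ around $t=0$. For nonzero $\lambda\in\mathbb{R}$ and complex $z$, the degenerate exponential is $e_\lambda^{z}(t)=(1+\lambda t)^{z/\lambda}$. The degenerate cosine and sine functions are $\cos_\lambda^{(y)}(t)=\frac{e_\lambda^{iy}(t)+e_\lambda^{-iy}(t)}{2}=\cos\left(\frac{y}{\lambda}\log(1+\lambda t)\right)$ and $\sin_\lambda^{(y)}(t)=\frac{e_\lambda^{iy}(t)-e_\lambda^{-iy}(t)}{2i}=\sin\left(\frac{y}{\lambda}\log(1+\lambda t)\right)$, with $i=\sqrt{-1}$. The degenerate cosine-polynomials $C_{n,\lambda}(x,y)$ and degenerate sine-polynomials $S_{n,\lambda}(x,y)$ are defined by $e_\lambda^{x}(t)\cos_\lambda^{(y)}(t)=\sum_{n=0}^{\infty}C_{n,\lambda}(x,y)\frac{t^n}{n!}$ and $e_\lambda^{x}(t)\sin_\lambda^{(y)}(t)=\sum_{n=0}^{\infty}S_{n,\lambda}(x,y)\frac{t^n}{n!}$. The generalized falling factorials are $(x)_{0,\lambda}=1$, $(x)_{n,\lambda}=x(x-\lambda)(x-2\lambda)\cdots(x-(n-1)\lambda)$ for $n\ge1$. The (signed) Stirling numbers of the first kind $S^{(1)}(n,l)$ are defined by $x(x-1)\cdots(x-n+1)=\sum_{l=0}^{n}S^{(1)}(n,l)x^l$ (the empty product being $1$ for $n=0$). $[a]$ denotes the greatest integer $\le a$. *)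

theory Defs
  imports
    "HOL-Complex_Analysis.Complex_Analysis"
    "HOL-Computational_Algebra.Polynomial"
begin

(* Principal branch; it is analytic in t around 0, where the value is 1. *)
definition deg_exp :: "real \<Rightarrow> complex \<Rightarrow> complex \<Rightarrow> complex" where
  "deg_exp lam z t = (1 + of_real lam * t) powr (z / of_real lam)"

definition deg_cos :: "real \<Rightarrow> real \<Rightarrow> complex \<Rightarrow> complex" where
  "deg_cos lam y t =
     (deg_exp lam (\<i> * of_real y) t + deg_exp lam (- (\<i> * of_real y)) t) / 2"

definition deg_sin :: "real \<Rightarrow> real \<Rightarrow> complex \<Rightarrow> complex" where
  "deg_sin lam y t =
     (deg_exp lam (\<i> * of_real y) t - deg_exp lam (- (\<i> * of_real y)) t) / (2 * \<i>)"

(* n! times the n-th coefficient of the power series of f around 0;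
   meaningful when f is analytic at 0, see egf_coeff_sums. *)
definition egf_coeff :: "(complex \<Rightarrow> complex) \<Rightarrow> nat \<Rightarrow> complex" where
  "egf_coeff f n = fact n * fps_nth (fps_expansion f 0) n"

definition cos_poly :: "nat \<Rightarrow> real \<Rightarrow> real \<Rightarrow> real \<Rightarrow> complex" where
  "cos_poly n lam x y = egf_coeff (\<lambda>t. deg_exp lam (of_real x) t * deg_cos lam y t) n"

definition sin_poly :: "nat \<Rightarrow> real \<Rightarrow> real \<Rightarrow> real \<Rightarrow> complex" where
  "sin_poly n lam x y = egf_coeff (\<lambda>t. deg_exp lam (of_real x) t * deg_sin lam y t) n"

definition gen_ffact :: "real \<Rightarrow> real \<Rightarrow> nat \<Rightarrow> real" where
  "gen_ffact lam x n = (\<Prod>i<n. x - of_nat i * lam)"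

(* The polynomial identity in x defining the signed numbers is read off coefficientwise;
   the constant stirling of HOL-Combinatorics is the unsigned variant. *)
definition stirling1 :: "nat \<Rightarrow> nat \<Rightarrow> real" where
  "stirling1 n l = coeff (\<Prod>i<n. [:- of_nat i, 1:]) l"


lemma stirling1_generating:
  "(\<Prod>i<n. x - of_nat i) = (\<Sum>l\<le>n. stirling1 n l * x ^ l)"
proof -
  define p :: "real poly" where "p = (\<Prod>i<n. [:- of_nat i, 1:])"
  have "degree p = n"
    unfolding p_def by (subst degree_prod_eq_sum_degree) auto
  hence "poly p x = (\<Sum>l\<le>n. stirling1 n l * x ^ l)"
    by (simp add: poly_altdef stirling1_def p_def)
  thus ?thesis by (simp add: p_def poly_prod)
qed

lemma deg_exp_analytic [analytic_intros]: "deg_exp lam z analytic_on {0}"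
  unfolding deg_exp_def by (intro analytic_intros) auto

lemma deg_cos_analytic [analytic_intros]: "deg_cos lam y analytic_on {0}"
  unfolding deg_cos_def by (intro analytic_intros) auto

lemma deg_sin_analytic [analytic_intros]: "deg_sin lam y analytic_on {0}"
  unfolding deg_sin_def by (intro analytic_intros) auto

lemma deg_cos_eq:
  assumes "1 + of_real lam * t \<noteq> 0"
  shows "deg_cos lam y t = cos (of_real (y / lam) * Ln (1 + of_real lam * t))"
  using assms by (simp add: deg_cos_def deg_exp_def powr_def cos_exp_eq algebra_simps)

lemma deg_sin_eq:
  assumes "1 + of_real lam * t \<noteq> 0"
  shows "deg_sin lam y t = sin (of_real (y / lam) * Ln (1 + of_real lam * t))"
  using assms by (simp add: deg_sin_def deg_exp_def powr_def sin_exp_eq algebra_simps)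

lemma egf_coeff_sums:
  assumes "f analytic_on {0}"
  shows "eventually (\<lambda>t. (\<lambda>n. egf_coeff f n * t ^ n / fact n) sums f t) (nhds 0)"
proof -
  let ?F = "fps_expansion f 0"
  have *: "f has_fps_expansion ?F"
    using assms by (rule analytic_at_imp_has_fps_expansion_0)
  hence r: "fps_conv_radius ?F > 0" and ev: "eventually (\<lambda>t. eval_fps ?F t = f t) (nhds 0)"
    by (auto simp: has_fps_expansion_def)
  have "eventually (\<lambda>t. t \<in> eball 0 (fps_conv_radius ?F)) (nhds (0 :: complex))"
    using r by (intro eventually_nhds_in_open) (auto simp: zero_ereal_def)
  with ev show ?thesis
  proof eventually_elim
    case (elim t)
    hence "(\<lambda>n. fps_nth ?F n * t ^ n) sums eval_fps ?F t"
      by (intro sums_eval_fps) (auto simp: in_eball_iff)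
    with elim show ?case by (simp add: egf_coeff_def)
  qed
qed

lemma cos_poly_generating:
  "eventually (\<lambda>t. (\<lambda>n. cos_poly n lam x y * t ^ n / fact n) sums
     (deg_exp lam (of_real x) t * deg_cos lam y t)) (nhds 0)"
  unfolding cos_poly_def by (intro egf_coeff_sums analytic_intros)

lemma sin_poly_generating:
  "eventually (\<lambda>t. (\<lambda>n. sin_poly n lam x y * t ^ n / fact n) sums
     (deg_exp lam (of_real x) t * deg_sin lam y t)) (nhds 0)"
  unfolding sin_poly_def by (intro egf_coeff_sums analytic_intros)

end

theory Submission
  imports Defs
begin

text \<open>
  The coefficients of the degenerate exponential are given by the binomial series. Its
  \<open>m\<close>-th coefficient is a falling factorial with step \<open>\<lambda>\<close>, hence a homogeneous polynomial in
  the exponent and \<open>\<lambda>\<close> whose coefficients are Stirling numbers. Evaluating it at \<open>\<plusminus>iy\<close>, the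
  cosine keeps the even powers of \<open>y\<close> and the sine the odd ones; multiplying with the
  degenerate exponential at \<open>x\<close> is a binomial convolution of coefficients.
\<close>

section \<open>Arithmetic of exponential generating function coefficients\<close>

lemma egf_coeff_eqI:
  assumes "f has_fps_expansion F"
  shows "egf_coeff f n = fact n * fps_nth F n"
  \<comment> \<open>Expansions are unique: both series have the \<open>n\<close>-th derivative of
    \<open>f\<close> at 0, divided by \<open>fact n\<close>, as coefficient.\<close>
  using fps_nth_fps_expansion[OF assms, of n] by (simp add: egf_coeff_def fps_expansion_def)

text \<open>Cauchy product, where the factorials turn into a binomial coefficient. The index
  \<open>m\<close> is attached to the second factor because that factor will be the cosine or sine,
  while the exponential at \<open>x\<close> receives \<open>n - m\<close>.\<close>

lemma egf_coeff_mult: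
  assumes "f analytic_on {0}" "g analytic_on {0}"
  shows "egf_coeff (\<lambda>t. f t * g t) n =
    (\<Sum>m\<le>n. of_nat (n choose m) * egf_coeff g m * egf_coeff f (n - m))"
proof -
  define F where "F = fps_expansion f 0"
  define G where "G = fps_expansion g 0"
  have F: "f has_fps_expansion F" and G: "g has_fps_expansion G"
    using assms by (auto simp: F_def G_def intro: analytic_at_imp_has_fps_expansion_0)
  have "egf_coeff (\<lambda>t. f t * g t) n = fact n * fps_nth (G * F) n"
    using egf_coeff_eqI[OF has_fps_expansion_mult[OF F G]] by (simp add: mult.commute)
  also have "\<dots> = (\<Sum>m\<le>n. fact n * (fps_nth G m * fps_nth F (n - m)))"
    by (simp add: fps_mult_nth sum_distrib_left atLeast0AtMost)
  also have "\<dots> = (\<Sum>m\<le>n. of_nat (n choose m) * egf_coeff g m * egf_coeff f (n - m))"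
    by (intro sum.cong refl)
       (simp add: egf_coeff_eqI[OF F] egf_coeff_eqI[OF G] binomial_fact field_simps)
  finally show ?thesis .
qed

lemma egf_coeff_add:
  assumes "f analytic_on {0}" "g analytic_on {0}"
  shows "egf_coeff (\<lambda>t. f t + g t) n = egf_coeff f n + egf_coeff g n"
proof -
  note F = assms[THEN analytic_at_imp_has_fps_expansion_0]
  show ?thesis
    by (simp add: egf_coeff_eqI[OF has_fps_expansion_add[OF F]] egf_coeff_def algebra_simps)
qed

lemma egf_coeff_cmult:
  assumes "f analytic_on {0}"
  shows "egf_coeff (\<lambda>t. c * f t) n = c * egf_coeff f n"
proof -
  note F = assms[THEN analytic_at_imp_has_fps_expansion_0]
  show ?thesis
    by (simp add: egf_coeff_eqI[OF has_fps_expansion_cmult_left[OF F]] egf_coeff_def)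
qed

section \<open>Coefficients of the degenerate exponential\<close>

lemma egf_coeff_deg_exp:
  assumes "lam \<noteq> 0"
  shows "egf_coeff (deg_exp lam z) n = (\<Prod>i<n. z - of_nat i * of_real lam)"
proof -
  define F where "F = fps_binomial (z / of_real lam) oo (fps_const (complex_of_real lam) * fps_X)"
  \<comment> \<open>The inner series has constant term 0, so the formal composition is legitimate;
    it scales the \<open>n\<close>-th binomial coefficient by \<open>lam ^ n\<close>.\<close>
  have "deg_exp lam z = (\<lambda>t. (1 + t) powr (z / of_real lam)) \<circ> (\<lambda>t. of_real lam * t)"
    by (simp add: fun_eq_iff deg_exp_def)
  hence "deg_exp lam z has_fps_expansion F"
    unfolding F_def
    by (auto intro!: has_fps_expansion_compose fps_expansion_intros)
  hence "egf_coeff (deg_exp lam z) n =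
      of_real lam ^ n * (fact n * ((z / of_real lam) gchoose n))"
    by (simp add: egf_coeff_eqI F_def fps_compose_linear)
  \<comment> \<open>\<open>fact n\<close> clears the denominator of the generalized binomial
    coefficient, and each of the \<open>n\<close> remaining factors absorbs one
    \<open>lam\<close>.\<close>
  also have "\<dots> = (\<Prod>i<n. of_real lam * (z / of_real lam - of_nat i))"
    by (simp add: gbinomial_mult_fact prod.distrib atLeast0LessThan)
  also have "\<dots> = (\<Prod>i<n. z - of_nat i * of_real lam)"
    using assms by (intro prod.cong) (auto simp: algebra_simps)
  finally show ?thesis .
qed

lemma egf_coeff_deg_exp_of_real:
  assumes "lam \<noteq> 0"
  shows "egf_coeff (deg_exp lam (of_real x)) n = of_real (gen_ffact lam x n)"
  using assms by (simp add: egf_coeff_deg_exp gen_ffact_def)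

section \<open>Stirling recurrence and homogeneous falling factorials\<close>

lemma stirling1_0: "stirling1 0 l = (if l = 0 then 1 else 0)"
  by (simp add: stirling1_def)

lemma stirling1_Suc_0: "stirling1 (Suc n) 0 = - of_nat n * stirling1 n 0"
  by (simp add: stirling1_def mult.commute)

text \<open>Compare coefficients after splitting off the last linear factor, x - n, of the falling
  factorial.\<close>

lemma stirling1_Suc_Suc:
  "stirling1 (Suc n) (Suc l) = stirling1 n l - of_nat n * stirling1 n (Suc l)"
proof -
  have "(\<Prod>i<Suc n. [:- of_nat i, 1:]) =
      [:- of_nat n, 1:] * (\<Prod>i<n. [:- of_nat i, 1 :: real:])"
    by simp
  thus ?thesis
    unfolding stirling1_def by (simp only: mult_pCons_left) simp
qed

lemma stirling1_eq_0: "n < l \<Longrightarrow> stirling1 n l = 0"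
proof (induction n arbitrary: l)
  case 0
  thus ?case by (simp add: stirling1_0)
next
  case (Suc n)
  then obtain l' where "l = Suc l'" by (cases l) auto
  with Suc show ?case by (simp add: stirling1_Suc_Suc)
qed

text \<open>The defining identity of the Stirling numbers, homogenised by a step \<open>c\<close>.
  Induction through the recurrence avoids substituting z/c, so no division by \<open>c\<close>
  occurs.\<close>

lemma prod_diff_eq_sum_stirling1:
  fixes z c :: "'a :: {comm_ring_1, real_algebra_1}"
  shows "(\<Prod>i<n. z - of_nat i * c) = (\<Sum>l\<le>n. of_real (stirling1 n l) * c ^ (n - l) * z ^ l)"
proof (induction n)
  case 0
  thus ?case by (simp add: stirling1_0)
next
  case (Suc n)
  let ?t = "\<lambda>n l. of_real (stirling1 n l) * c ^ (n - l) * z ^ l :: 'a"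
  have "(\<Sum>l\<le>n. ?t n l) * (z - of_nat n * c) =
      (\<Sum>l\<le>n. of_real (stirling1 n l) * c ^ (n - l) * z ^ Suc l) -
      (\<Sum>l\<le>n. of_nat n * of_real (stirling1 n l) * c ^ (Suc n - l) * z ^ l)"
    by (simp add: algebra_simps sum_distrib_left sum_distrib_right sum_subtractf Suc_diff_le)
  \<comment> \<open>The added term is 0 since \<open>stirling1 n (Suc n) = 0\<close>. With the range
    up to \<open>Suc n\<close>, splitting off \<open>l = 0\<close> and shifting the index leaves
    powers \<open>z ^ Suc l\<close> with \<open>l \<le> n\<close>, as in the first sum, and the
    recurrence applies termwise.\<close>
  also have "(\<Sum>l\<le>n. of_nat n * of_real (stirling1 n l) * c ^ (Suc n - l) * z ^ l) =
      (\<Sum>l\<le>Suc n. of_nat n * of_real (stirling1 n l) * c ^ (Suc n - l) * z ^ l)"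
    by (simp add: stirling1_eq_0)
  also have "\<dots> = of_nat n * of_real (stirling1 n 0) * c ^ Suc n +
      (\<Sum>l\<le>n. of_nat n * of_real (stirling1 n (Suc l)) * c ^ (n - l) * z ^ Suc l)"
    by (subst sum.atMost_Suc_shift) simp
  also have "(\<Sum>l\<le>n. of_real (stirling1 n l) * c ^ (n - l) * z ^ Suc l) - \<dots> =
      ?t (Suc n) 0 + (\<Sum>l\<le>n. ?t (Suc n) (Suc l))"
    by (simp add: stirling1_Suc_0 stirling1_Suc_Suc algebra_simps flip: sum_subtractf)
  also have "\<dots> = (\<Sum>l\<le>Suc n. ?t (Suc n) l)"
    by (rule sum.atMost_Suc_shift [symmetric])
  finally show ?case
    using Suc by simp
qed

section \<open>Sums supported on indices of one parity\<close>

lemma sum_even_indices: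
  fixes f :: "nat \<Rightarrow> 'a :: comm_monoid_add"
  assumes "\<And>l. odd l \<Longrightarrow> f l = 0"
  shows "(\<Sum>l\<le>m. f l) = (\<Sum>k=0..m div 2. f (2 * k))"
proof -
  have "(\<Sum>l\<le>m. f l) = (\<Sum>l | l \<le> m \<and> even l. f l)"
    by (rule sum.mono_neutral_right) (use assms in auto)
  also have "\<dots> = (\<Sum>k=0..m div 2. f (2 * k))"
    by (rule sum.reindex_bij_witness[where i = "\<lambda>k. 2 * k" and j = "\<lambda>l. l div 2"]) auto
  finally show ?thesis .
qed

text \<open>The bound \<open>m \<ge> 1\<close> matters: for \<open>m = 0\<close> truncated
  subtraction would leave the term \<open>f 1\<close> on the right, but only \<open>f 0\<close> on
  the left.\<close>

lemma sum_odd_indices: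
  fixes f :: "nat \<Rightarrow> 'a :: comm_monoid_add"
  assumes "\<And>l. even l \<Longrightarrow> f l = 0" and "m \<ge> 1"
  shows "(\<Sum>l\<le>m. f l) = (\<Sum>k=0..(m - 1) div 2. f (2 * k + 1))"
proof -
  have "(\<Sum>l\<le>m. f l) = (\<Sum>l | l \<le> m \<and> odd l. f l)"
    by (rule sum.mono_neutral_right) (use assms in auto)
  also have "\<dots> = (\<Sum>k=0..(m - 1) div 2. f (2 * k + 1))"
    by (rule sum.reindex_bij_witness[where i = "\<lambda>k. 2 * k + 1" and j = "\<lambda>l. (l - 1) div 2"])
      (use assms(2) in \<open>auto elim!: oddE\<close>)
  finally show ?thesis .
qed

section \<open>Coefficients of the degenerate cosine and sine\<close>

lemma egf_coeff_deg_exp_imaginary: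
  assumes "lam \<noteq> 0"
  shows "egf_coeff (deg_exp lam (\<i> * of_real y)) m =
    (\<Sum>l\<le>m. of_real (stirling1 m l * lam ^ (m - l) * y ^ l) * \<i> ^ l)"
  using assms
  by (simp add: egf_coeff_deg_exp prod_diff_eq_sum_stirling1 power_mult_distrib mult_ac)

text \<open>Replace y by -y and move the sign from the power of y to the power of i. Both expansions
  then share their real coefficients and can be combined termwise.\<close>

lemma egf_coeff_deg_exp_minus_imaginary:
  assumes "lam \<noteq> 0"
  shows "egf_coeff (deg_exp lam (- (\<i> * of_real y))) m =
    (\<Sum>l\<le>m. of_real (stirling1 m l * lam ^ (m - l) * y ^ l) * (- \<i>) ^ l)"
  using egf_coeff_deg_exp_imaginary[OF assms, of "- y" m]
  by (simp add: power_minus[of y] power_minus[of \<i>] mult_ac)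

lemma egf_coeff_deg_cos:
  assumes "lam \<noteq> 0"
  shows "egf_coeff (deg_cos lam y) m = of_real
    (\<Sum>k=0..m div 2. lam ^ (m - 2 * k) * (- 1) ^ k * y ^ (2 * k) * stirling1 m (2 * k))"
proof -
  let ?a = "\<lambda>l. of_real (stirling1 m l * lam ^ (m - l) * y ^ l) :: complex"
  have i_powers: "\<i> ^ (2 * k) + (- \<i>) ^ (2 * k) = 2 * (- 1) ^ k" for k
    by (simp add: power_mult)
  have "deg_cos lam y =
      (\<lambda>t. 1 / 2 * (deg_exp lam (\<i> * of_real y) t + deg_exp lam (- (\<i> * of_real y)) t))"
    by (simp add: fun_eq_iff deg_cos_def)
  hence "egf_coeff (deg_cos lam y) m = 1 / 2 *
      (egf_coeff (deg_exp lam (\<i> * of_real y)) m + egf_coeff (deg_exp lam (- (\<i> * of_real y))) m)"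
    by (simp only: egf_coeff_cmult egf_coeff_add deg_exp_analytic analytic_on_add)
  also have "\<dots> = (\<Sum>l\<le>m. ?a l * (\<i> ^ l + (- \<i>) ^ l) / 2)"
    unfolding egf_coeff_deg_exp_imaginary[OF assms] egf_coeff_deg_exp_minus_imaginary[OF assms]
    by (simp add: distrib_left sum.distrib add_divide_distrib sum_divide_distrib)
  \<comment> \<open>For odd \<open>l\<close> the powers of i and -i cancel.\<close>
  also have "\<dots> = (\<Sum>k=0..m div 2. ?a (2 * k) * (\<i> ^ (2 * k) + (- \<i>) ^ (2 * k)) / 2)"
    by (rule sum_even_indices) (simp add: power_minus_odd)
  also have "\<dots> = of_real
      (\<Sum>k=0..m div 2. lam ^ (m - 2 * k) * (- 1) ^ k * y ^ (2 * k) * stirling1 m (2 * k))"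
    unfolding of_real_sum by (intro sum.cong refl) (simp add: i_powers)
  finally show ?thesis .
qed

text \<open>The sum is kept over all \<open>l\<close>, before any split by parity, so that it covers
  \<open>m = 0\<close> as well as \<open>m \<ge> 1\<close>.\<close>

lemma egf_coeff_deg_sin_eq_sum:
  assumes "lam \<noteq> 0"
  shows "egf_coeff (deg_sin lam y) m =
    (\<Sum>l\<le>m. of_real (stirling1 m l * lam ^ (m - l) * y ^ l) * (\<i> ^ l - (- \<i>) ^ l) / (2 * \<i>))"
proof -
  \<comment> \<open>Writing the difference with the scalar -1 reduces it to additivity and scalar
    multiples.\<close>
  have "deg_sin lam y = (\<lambda>t. 1 / (2 * \<i>) *
      (deg_exp lam (\<i> * of_real y) t + (- 1) * deg_exp lam (- (\<i> * of_real y)) t))"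
    by (simp add: fun_eq_iff deg_sin_def)
  hence "egf_coeff (deg_sin lam y) m = 1 / (2 * \<i>) *
      (egf_coeff (deg_exp lam (\<i> * of_real y)) m +
        (- 1) * egf_coeff (deg_exp lam (- (\<i> * of_real y))) m)"
    by (simp only: egf_coeff_cmult egf_coeff_add deg_exp_analytic analytic_on_add
        analytic_on_mult analytic_on_const)
  also have "\<dots> = (\<Sum>l\<le>m. of_real (stirling1 m l * lam ^ (m - l) * y ^ l) *
      (\<i> ^ l - (- \<i>) ^ l) / (2 * \<i>))"
    unfolding egf_coeff_deg_exp_imaginary[OF assms] egf_coeff_deg_exp_minus_imaginary[OF assms]
    by (simp add: right_diff_distrib sum_subtractf diff_divide_distrib sum_divide_distrib
        sum_distrib_left sum_negf)
  finally show ?thesis .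
qed

lemma egf_coeff_deg_sin_0:
  assumes "lam \<noteq> 0"
  shows "egf_coeff (deg_sin lam y) 0 = 0"
  using assms by (simp add: egf_coeff_deg_sin_eq_sum)

lemma egf_coeff_deg_sin:
  assumes "lam \<noteq> 0" and "m \<ge> 1"
  shows "egf_coeff (deg_sin lam y) m = of_real
    (\<Sum>k=0..(m - 1) div 2.
      lam ^ (m - 2 * k - 1) * (- 1) ^ k * y ^ (2 * k + 1) * stirling1 m (2 * k + 1))"
proof -
  let ?a = "\<lambda>l. of_real (stirling1 m l * lam ^ (m - l) * y ^ l) :: complex"
  have i_powers: "\<i> ^ (2 * k + 1) - (- \<i>) ^ (2 * k + 1) = 2 * \<i> * (- 1) ^ k" for k
    by (simp add: power_mult)
  have "egf_coeff (deg_sin lam y) m = (\<Sum>l\<le>m. ?a l * (\<i> ^ l - (- \<i>) ^ l) / (2 * \<i>))"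
    using assms by (simp add: egf_coeff_deg_sin_eq_sum)
  \<comment> \<open>For even \<open>l\<close> the powers of i and -i agree, so their difference
    vanishes.\<close>
  also have "\<dots> = (\<Sum>k=0..(m - 1) div 2.
      ?a (2 * k + 1) * (\<i> ^ (2 * k + 1) - (- \<i>) ^ (2 * k + 1)) / (2 * \<i>))"
    using assms(2) by (intro sum_odd_indices) simp_all
  also have "\<dots> = of_real (\<Sum>k=0..(m - 1) div 2.
      lam ^ (m - 2 * k - 1) * (- 1) ^ k * y ^ (2 * k + 1) * stirling1 m (2 * k + 1))"
    unfolding of_real_sum i_powers by (intro sum.cong refl) (simp add: mult_ac)
  finally show ?thesis .
qed

section \<open>Binomial convolution and interchange of summation\<close>

lemma cos_poly_eq_sum:
  assumes "lam \<noteq> 0"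
  shows "cos_poly n lam x y = of_real
    (\<Sum>m=0..n. \<Sum>k=0..m div 2.
       real (n choose m) * lam ^ (m - 2 * k) * (- 1) ^ k * y ^ (2 * k)
         * stirling1 m (2 * k) * gen_ffact lam x (n - m))"
  unfolding cos_poly_def
  by (simp add: egf_coeff_mult deg_exp_analytic deg_cos_analytic egf_coeff_deg_exp_of_real
      egf_coeff_deg_cos assms sum_distrib_left sum_distrib_right mult.assoc atLeast0AtMost)

lemma sin_poly_eq_sum:
  assumes "lam \<noteq> 0"
  shows "sin_poly n lam x y = of_real
    (\<Sum>m=1..n. \<Sum>k=0..(m - 1) div 2.
       real (n choose m) * lam ^ (m - 2 * k - 1) * (- 1) ^ k * y ^ (2 * k + 1)
         * stirling1 m (2 * k + 1) * gen_ffact lam x (n - m))"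
proof -
  have "sin_poly n lam x y =
      (\<Sum>m=0..n. of_nat (n choose m) * egf_coeff (deg_sin lam y) m
        * of_real (gen_ffact lam x (n - m)))"
    unfolding sin_poly_def
    by (simp add: egf_coeff_mult deg_exp_analytic deg_sin_analytic egf_coeff_deg_exp_of_real
        assms atLeast0AtMost)
  \<comment> \<open>The term \<open>m = 0\<close> disappears because the sine series has no constant
    term.\<close>
  also have "\<dots> = (\<Sum>m=1..n. of_nat (n choose m) * egf_coeff (deg_sin lam y) m
        * of_real (gen_ffact lam x (n - m)))"
    by (subst sum.atLeast_Suc_atMost) (simp_all add: egf_coeff_deg_sin_0 assms)
  also have "\<dots> = (\<Sum>m=1..n. of_real (\<Sum>k=0..(m - 1) div 2.
       real (n choose m) * lam ^ (m - 2 * k - 1) * (- 1) ^ k * y ^ (2 * k + 1)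
         * stirling1 m (2 * k + 1) * gen_ffact lam x (n - m)))"
    by (intro sum.cong refl)
      (simp add: egf_coeff_deg_sin assms sum_distrib_left sum_distrib_right mult.assoc)
  finally show ?thesis by simp
qed

text \<open>Both sides range over the pairs with \<open>2 * k \<le> m \<le> n\<close>; swapping the
  components is its own inverse.\<close>

lemma sum_swap_even:
  fixes f :: "nat \<Rightarrow> nat \<Rightarrow> 'a :: comm_monoid_add"
  shows "(\<Sum>m=0..n. \<Sum>k=0..m div 2. f m k) = (\<Sum>k=0..n div 2. \<Sum>m=2*k..n. f m k)"
  unfolding sum.Sigma[OF finite_atLeastAtMost ballI[OF finite_atLeastAtMost]]
  by (rule sum.reindex_bij_witness[where i = prod.swap and j = prod.swap]) auto

text \<open>Both sides range over the pairs with \<open>2 * k + 1 \<le> m \<le> n\<close>. For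
  \<open>n = 0\<close> the right side still has the index \<open>k = 0\<close>, but its inner sum is
  empty.\<close>

lemma sum_swap_odd:
  fixes f :: "nat \<Rightarrow> nat \<Rightarrow> 'a :: comm_monoid_add"
  shows "(\<Sum>m=1..n. \<Sum>k=0..(m - 1) div 2. f m k) =
    (\<Sum>k=0..(n - 1) div 2. \<Sum>m=2*k+1..n. f m k)"
  unfolding sum.Sigma[OF finite_atLeastAtMost ballI[OF finite_atLeastAtMost]]
  by (rule sum.reindex_bij_witness[where i = prod.swap and j = prod.swap]) auto

theorem theorem2p2:
  fixes lam x y :: real
  assumes "lam \<noteq> 0"
  shows "(\<forall>n.
      cos_poly n lam x y = complex_of_real
        (\<Sum>m=0..n. \<Sum>k=0..m div 2.
           real (n choose m) * lam ^ (m - 2 * k) * (- 1) ^ k * y ^ (2 * k)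
             * stirling1 m (2 * k) * gen_ffact lam x (n - m)) \<and>
      cos_poly n lam x y = complex_of_real
        (\<Sum>k=0..n div 2. \<Sum>m=2*k..n.
           real (n choose m) * lam ^ (m - 2 * k) * (- 1) ^ k * y ^ (2 * k)
             * stirling1 m (2 * k) * gen_ffact lam x (n - m))) \<and>
    (\<forall>n\<ge>1.
      sin_poly n lam x y = complex_of_real
        (\<Sum>m=1..n. \<Sum>k=0..(m - 1) div 2.
           real (n choose m) * lam ^ (m - 2 * k - 1) * (- 1) ^ k * y ^ (2 * k + 1)
             * stirling1 m (2 * k + 1) * gen_ffact lam x (n - m)) \<and>
      sin_poly n lam x y = complex_of_real
        (\<Sum>k=0..(n - 1) div 2. \<Sum>m=2*k+1..n.
           real (n choose m) * lam ^ (m - 2 * k - 1) * (- 1) ^ k * y ^ (2 * k + 1)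
             * stirling1 m (2 * k + 1) * gen_ffact lam x (n - m))) \<and>
    sin_poly 0 lam x y = 0"
proof (intro conjI allI impI)
  fix n
  show "cos_poly n lam x y = complex_of_real
        (\<Sum>m=0..n. \<Sum>k=0..m div 2.
           real (n choose m) * lam ^ (m - 2 * k) * (- 1) ^ k * y ^ (2 * k)
             * stirling1 m (2 * k) * gen_ffact lam x (n - m))"
    by (rule cos_poly_eq_sum[OF assms])
  thus "cos_poly n lam x y = complex_of_real
        (\<Sum>k=0..n div 2. \<Sum>m=2*k..n.
           real (n choose m) * lam ^ (m - 2 * k) * (- 1) ^ k * y ^ (2 * k)
             * stirling1 m (2 * k) * gen_ffact lam x (n - m))"
    by (simp only: sum_swap_even)
next
  fix n :: nat
  show "sin_poly n lam x y = complex_of_real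
        (\<Sum>m=1..n. \<Sum>k=0..(m - 1) div 2.
           real (n choose m) * lam ^ (m - 2 * k - 1) * (- 1) ^ k * y ^ (2 * k + 1)
             * stirling1 m (2 * k + 1) * gen_ffact lam x (n - m))"
    by (rule sin_poly_eq_sum[OF assms])
  thus "sin_poly n lam x y = complex_of_real
        (\<Sum>k=0..(n - 1) div 2. \<Sum>m=2*k+1..n.
           real (n choose m) * lam ^ (m - 2 * k - 1) * (- 1) ^ k * y ^ (2 * k + 1)
             * stirling1 m (2 * k + 1) * gen_ffact lam x (n - m))"
    by (simp only: sum_swap_odd)
next
  \<comment> \<open>The outer sum, from 1 to 0, is empty.\<close>
  show "sin_poly 0 lam x y = 0"
    by (simp add: sin_poly_eq_sum[OF assms])
qed

end
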